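(* For every integer $t\geq 2$, every (finite, simple) graph with average degree at least $2^{t-2}$ has a dominating $K_t$-model.
   Context: A dominating $K_t$-model in a graph $G$ is a sequence $(T_1,\dots,T_t)$ of pairwise disjoint non-empty connected subgraphs of $G$ such that for all $1\le i<j\le t$, every vertex of $T_j$ has a neighbour in $T_i$. The average degree of a graph $G$ with at least one vertex is $2|E(G)|/|V(G)|$. *)

theory Defs
  imports Complex_Main "Graph_Theory.Digraph_Component"
begin

text \<open>
  A finite simple graph is a \<^locale>\<open>graph\<close>: a finite, loop-free, symmetric digraph without
  parallel arcs. Each edge corresponds to two opposite arcs, so the edges are obtained as
  unordered pairs of end vertices.
\<close>

definition edges :: "('a, 'b) pre_digraph \<Rightarrow> 'a set set" where
  "edges G = {{u, v} | u v. u \<rightarrow>\<^bsub>G\<^esub> v}"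

definition average_degree :: "('a, 'b) pre_digraph \<Rightarrow> real" where
  "average_degree G = 2 * real (card (edges G)) / real (card (verts G))"

text \<open>
  The sequence is indexed by \<open>1, \<dots>, t\<close>; the values of \<open>T\<close> outside this range are irrelevant.
  The condition \<open>Digraph.graph (T i)\<close> is needed because the subgraph relation is that of digraphs
  and would otherwise admit only one of the two arcs of an edge.
\<close>

definition dominating_clique_model ::
    "('a, 'b) pre_digraph \<Rightarrow> nat \<Rightarrow> (nat \<Rightarrow> ('a, 'b) pre_digraph) \<Rightarrow> bool" where
  "dominating_clique_model G t T \<longleftrightarrow>
     (\<forall>i\<in>{1..t}. Digraph.graph (T i) \<and> subgraph (T i) G \<and>
        verts (T i) \<noteq> {} \<and> Digraph_Component.connected (T i)) \<and>
     (\<forall>i\<in>{1..t}. \<forall>j\<in>{1..t}. i \<noteq> j \<longrightarrow> verts (T i) \<inter> verts (T j) = {}) \<and>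
     (\<forall>i j. 1 \<le> i \<and> i < j \<and> j \<le> t \<longrightarrow>
        (\<forall>v\<in>verts (T j). \<exists>u\<in>verts (T i). v \<rightarrow>\<^bsub>G\<^esub> u))"

end

theory Submission
  imports Defs
begin

text \<open>
  The argument is Mader's for clique minors. In a graph with \<open>n\<close> vertices and at least \<open>k n\<close> edges
  (\<open>k > 0\<close>), contract a connected set \<open>U\<close>, as large as possible, such that the resulting graph still
  has at least \<open>k\<close> times as many edges as vertices. Contracting a further neighbour \<open>v\<close> of \<open>U\<close> would
  lose one vertex, and one edge more than \<open>v\<close> has neighbours in \<open>N(U)\<close>; so by maximality \<open>N(U)\<close>
  induces a graph of minimum degree at least \<open>k\<close>. Every vertex of \<open>N(U)\<close> has a neighbour in \<open>U\<close>, so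
  \<open>U\<close> can be put in front of a dominating model found inside \<open>N(U)\<close>, at the cost of halving the
  average degree.
\<close>

section \<open>Connected vertex sets\<close>

definition connected_on :: "'a rel \<Rightarrow> 'a set \<Rightarrow> bool" where
  "connected_on E U \<longleftrightarrow> U \<noteq> {} \<and> (\<forall>x\<in>U. \<forall>y\<in>U. (x, y) \<in> rtrancl_on U E)"

lemma connected_on_singleton: "connected_on E {v}"
  by (simp add: connected_on_def)

lemma rtrancl_on_mono_set:
  assumes "(x, y) \<in> rtrancl_on U E" "U \<subseteq> V"
  shows "(x, y) \<in> rtrancl_on V E"
  using assms by induct (auto intro: converse_rtrancl_on_into_rtrancl_on)

text \<open>Inside the enlarged set every vertex reaches \<open>u\<close> and is reached from it, so
  walks compose through \<open>u\<close>. Both arcs are assumed because \<open>E\<close> may be any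
  relation here.\<close>

lemma connected_on_insert:
  assumes "connected_on E U" "u \<in> U" "(u, v) \<in> E" "(v, u) \<in> E"
  shows "connected_on E (insert v U)"
proof -
  let ?R = "rtrancl_on (insert v U) E"
  have U: "(x, y) \<in> ?R" if "x \<in> U" "y \<in> U" for x y
    using assms(1) that by (auto simp: connected_on_def intro: rtrancl_on_mono_set)
  have uv: "(u, v) \<in> ?R" "(v, u) \<in> ?R"
    using assms by (auto intro: rtrancl_on_into_rtrancl_on[OF rtrancl_on_refl])
  have "(x, u) \<in> ?R \<and> (u, x) \<in> ?R" if "x \<in> insert v U" for x
    using that U uv assms(2) by auto
  then have "(x, y) \<in> ?R" if "x \<in> insert v U" "y \<in> insert v U" for x y
    using that rtrancl_on_trans[of x u "insert v U" E y] by blast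
  then show ?thesis
    by (auto simp: connected_on_def)
qed

section \<open>Counting edges as ordered pairs\<close>

text \<open>Ordered pairs count each edge twice, hence the factor 2; irreflexivity keeps the pairs
  leaving \<open>v\<close> disjoint from those entering it.\<close>

lemma card_edges_remove:
  assumes "sym E" "irrefl E" "finite W" "v \<in> W"
  shows "card (E \<inter> W \<times> W) =
    card (E \<inter> (W - {v}) \<times> (W - {v})) + 2 * card (W \<inter> E `` {v})"
proof -
  let ?N = "W \<inter> E `` {v}"
  have 1: "E \<inter> W \<times> W =
      E \<inter> (W - {v}) \<times> (W - {v}) \<union> (Pair v ` ?N \<union> (\<lambda>w. (w, v)) ` ?N)"
    using assms(1,4) by (auto simp: sym_def)
  have c: "card (Pair v ` ?N) = card ?N" "card ((\<lambda>w. (w, v)) ` ?N) = card ?N"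
    by (auto intro!: card_image inj_onI)
  have "card (Pair v ` ?N \<union> (\<lambda>w. (w, v)) ` ?N) = 2 * card ?N"
    using assms(2,3) c by (subst card_Un_disjoint) (auto simp: irrefl_def)
  then show ?thesis
    using assms(3) by (subst 1, subst card_Un_disjoint) auto
qed

lemma card_edges_eq_sum_degrees:
  assumes "finite S"
  shows "card (E \<inter> S \<times> S) = (\<Sum>v\<in>S. card (S \<inter> E `` {v}))"
proof -
  have "E \<inter> S \<times> S = (SIGMA v:S. S \<inter> E `` {v})"
    by auto
  then show ?thesis
    using assms by simp
qed

section \<open>Contraction to a dense neighbourhood\<close>

text \<open>
  The hypothesis on \<open>k\<close> says that contracting \<open>U\<close> in the graph on \<open>U \<union> W\<close> leaves at least \<open>k\<close> times as
  many edges as vertices; edges inside \<open>W\<close> are counted as ordered pairs. If \<open>U\<close> has no neighbour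
  in \<open>W\<close>, it can be discarded in favour of a single vertex of \<open>W\<close>.
\<close>

lemma connected_with_dense_neighbourhood:
  assumes "sym E" "irrefl E" "0 < k"
    and "finite W" "U \<inter> W = {}" "U \<union> W \<subseteq> V" "connected_on E U"
    and "2 * k * (card W + 1) \<le> card (E \<inter> W \<times> W) + 2 * card (W \<inter> E `` U)"
  shows "\<exists>U' S. connected_on E U' \<and> U' \<subseteq> V \<and> S \<subseteq> V \<and> U' \<inter> S = {} \<and> S \<noteq> {} \<and>
    S \<subseteq> E `` U' \<and> (\<forall>v\<in>S. k \<le> card (S \<inter> E `` {v}))"
  using assms(4-8)
proof (induction "card W" arbitrary: W U)
  case 0
  then show ?case using assms(3) by simp
next
  case (Suc n)
  let ?N = "W \<inter> E `` U"
  have smaller: "card (W - {v}) = n" "card W = n + 1" if "v \<in> W" for v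
    using Suc.hyps(2) Suc.prems(1) that by auto
  show ?case
  proof (cases "?N = {}")
    case True
    obtain w where w: "w \<in> W"
      using Suc.hyps(2) by fastforce
    have "(W - {w}) \<inter> E `` {w} = W \<inter> E `` {w}"
      using assms(2) by (auto simp: irrefl_def)
    then have "card (E \<inter> W \<times> W) =
        card (E \<inter> (W - {w}) \<times> (W - {w})) + 2 * card ((W - {w}) \<inter> E `` {w})"
      using card_edges_remove[OF assms(1,2) Suc.prems(1) w] by simp
    moreover have "2 * k * (n + 1) \<le> 2 * k * (n + 1 + 1)"
      by simp
    ultimately have dense: "2 * k * (card (W - {w}) + 1) \<le>
        card (E \<inter> (W - {w}) \<times> (W - {w})) + 2 * card ((W - {w}) \<inter> E `` {w})"
      using Suc.prems(5) smaller[OF w] True by simp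
    have "{w} \<inter> (W - {w}) = {}" "{w} \<union> (W - {w}) \<subseteq> V"
      using w Suc.prems(3) by auto
    from smaller(1)[OF w, symmetric] finite_Diff[OF Suc.prems(1)] this connected_on_singleton dense
    show ?thesis
      by (rule Suc.hyps(1))
  next
    case nonempty: False
    show ?thesis
    proof (cases "\<forall>v\<in>?N. k \<le> card (?N \<inter> E `` {v})")
      case True
      then show ?thesis
        using nonempty Suc.prems(2-4)
        by - (rule exI[of _ U], rule exI[of _ ?N], intro conjI; blast)
    next
      case False
      then obtain v u where v: "v \<in> W" "u \<in> U" "(u, v) \<in> E"
        and deg: "card (?N \<inter> E `` {v}) < k"
        by force
      have conn: "connected_on E (insert v U)"
        using connected_on_insert[OF Suc.prems(4) v(2,3)] v(3) assms(1) by (auto simp: sym_def)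
      let ?W = "W - {v}" and ?D = "W \<inter> E `` {v}"
      have "insert v (?W \<inter> E `` insert v U) = ?N \<union> ?D"
        using v assms(2) by (auto simp: irrefl_def)
      then have "card (?W \<inter> E `` insert v U) + 1 = card (?N \<union> ?D)"
        using Suc.prems(1) by (metis (no_types, lifting) DiffD2 IntD1 Suc_eq_plus1 card_insert_disjoint
            finite_Diff finite_Int singletonI)
      moreover have "card (?N \<union> ?D) + card (?N \<inter> E `` {v}) = card ?N + card ?D"
      proof -
        have "?N \<inter> ?D = ?N \<inter> E `` {v}"
          by auto
        then show ?thesis
          using card_Un_Int[of ?N ?D] Suc.prems(1) by simp
      qed
      ultimately have dense: "2 * k * (card ?W + 1) \<le>
          card (E \<inter> ?W \<times> ?W) + 2 * card (?W \<inter> E `` insert v U)"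
        using card_edges_remove[OF assms(1,2) Suc.prems(1) v(1)] Suc.prems(5) deg smaller[OF v(1)]
        by (simp add: add_mult_distrib2)
      have "insert v U \<inter> ?W = {}" "insert v U \<union> ?W \<subseteq> V"
        using v(1) Suc.prems(2,3) by auto
      from smaller(1)[OF v(1), symmetric] finite_Diff[OF Suc.prems(1)] this conn dense
      show ?thesis
        by (rule Suc.hyps(1))
    qed
  qed
qed

section \<open>Dominating sequences of connected sets\<close>

text \<open>Indices start at 0 so that \<open>case_nat\<close> can put a new set in front.\<close>

definition dominating_sets :: "'a rel \<Rightarrow> 'a set \<Rightarrow> nat \<Rightarrow> (nat \<Rightarrow> 'a set) \<Rightarrow> bool" where
  "dominating_sets E S n M \<longleftrightarrow>
     (\<forall>i<n. M i \<subseteq> S \<and> connected_on E (M i)) \<and>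
     (\<forall>i<n. \<forall>j<n. i \<noteq> j \<longrightarrow> M i \<inter> M j = {}) \<and>
     (\<forall>i j. i < j \<and> j < n \<longrightarrow> M j \<subseteq> E `` M i)"

text \<open>As pairs count edges twice, the density hypothesis says that \<open>S\<close> induces
  average degree at least \<open>2 ^ m\<close>; here \<open>m\<close> stands for
  \<open>t - 2\<close>.\<close>

lemma dominating_sets_exist:
  assumes "sym E" "irrefl E" "finite S" "S \<noteq> {}" "2 ^ m * card S \<le> card (E \<inter> S \<times> S)"
  shows "\<exists>M. dominating_sets E S (m + 2) M"
  using assms(3-5)
proof (induction m arbitrary: S)
  case 0
  then have "card (E \<inter> S \<times> S) \<noteq> 0"
    by auto
  then have "E \<inter> S \<times> S \<noteq> {}"
    by force
  then obtain u v where uv: "(u, v) \<in> E" "u \<in> S" "v \<in> S"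
    by blast
  then have "u \<noteq> v"
    using assms(2) by (auto simp: irrefl_def)
  with uv show ?case
    by (intro exI[of _ "\<lambda>i. if i = 0 then {u} else {v}"])
      (auto simp: dominating_sets_def connected_on_singleton less_Suc_eq numeral_2_eq_2)
next
  case (Suc m)
  obtain u where u: "u \<in> S"
    using Suc.prems by auto
  have "(S - {u}) \<inter> E `` {u} = S \<inter> E `` {u}"
    using assms(2) by (auto simp: irrefl_def)
  \<comment> \<open>Nothing is contracted at the start: the single vertex \<open>u\<close> serves as
    the contracted set, and \<open>2 ^ Suc m\<close> is read as \<open>2 * k\<close> with
    \<open>k = 2 ^ m\<close>.\<close>
  then have dense: "2 * 2 ^ m * (card (S - {u}) + 1) \<le>
      card (E \<inter> (S - {u}) \<times> (S - {u})) + 2 * card ((S - {u}) \<inter> E `` {u})"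
    using Suc.prems card_edges_remove[OF assms(1,2) Suc.prems(1) u] card_Suc_Diff1[OF Suc.prems(1) u]
    by simp
  have "(0 :: nat) < 2 ^ m" "{u} \<inter> (S - {u}) = {}" "{u} \<union> (S - {u}) \<subseteq> S"
    using u by auto
  from connected_with_dense_neighbourhood[OF assms(1,2) this(1) finite_Diff[OF Suc.prems(1)] this(2,3)
      connected_on_singleton dense]
  obtain U S' where "connected_on E U \<and> U \<subseteq> S \<and> S' \<subseteq> S \<and> U \<inter> S' = {} \<and> S' \<noteq> {} \<and>
      S' \<subseteq> E `` U \<and> (\<forall>v\<in>S'. 2 ^ m \<le> card (S' \<inter> E `` {v}))"
    by (elim exE) (rule that)
  then have U: "connected_on E U" "U \<subseteq> S" and S'S: "S' \<subseteq> S"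
    and S': "S' \<noteq> {}" "S' \<subseteq> E `` U" and disjU: "U \<inter> S' = {}"
    and deg: "\<And>v. v \<in> S' \<Longrightarrow> 2 ^ m \<le> card (S' \<inter> E `` {v})"
    by simp_all
  have fin: "finite S'"
    using S'S Suc.prems(1) by (rule finite_subset)
  \<comment> \<open>Summing the minimum degree over \<open>S'\<close> gives the average degree
    needed for the induction hypothesis.\<close>
  have "2 ^ m * card S' \<le> card (E \<inter> S' \<times> S')"
    using sum_mono[of S' "\<lambda>_. 2 ^ m" "\<lambda>v. card (S' \<inter> E `` {v})"] deg
    by (simp add: card_edges_eq_sum_degrees[OF fin] mult.commute)
  from Suc.IH[OF fin S'(1) this] obtain M where
    "dominating_sets E S' (m + 2) M" ..
  then have M: "\<And>i. i < m + 2 \<Longrightarrow> M i \<subseteq> S' \<and> connected_on E (M i)"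
    and disj: "\<And>i j. i < m + 2 \<Longrightarrow> j < m + 2 \<Longrightarrow> i \<noteq> j \<Longrightarrow> M i \<inter> M j = {}"
    and dom: "\<And>i j. i < j \<Longrightarrow> j < m + 2 \<Longrightarrow> M j \<subseteq> E `` M i"
    by (simp_all add: dominating_sets_def)
  let ?M = "case_nat U M"
  have "?M i \<subseteq> S \<and> connected_on E (?M i)" if "i < Suc m + 2" for i
    using that U S'S M by (cases i) auto
  moreover have "?M i \<inter> ?M j = {}"
    if ij: "i < Suc m + 2" "j < Suc m + 2" "i \<noteq> j" for i j
  proof -
    have "U \<inter> M l = {}" "M l \<inter> U = {}" if "l < m + 2" for l
      using M[OF that] disjU by auto
    then show ?thesis
      using ij by (cases i; cases j) (simp_all add: disj)
  qed
  moreover have "?M j \<subseteq> E `` ?M i" if ij: "i < j" "j < Suc m + 2" for i j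
  proof -
    obtain j' where j': "j = Suc j'" "j' < m + 2"
      using ij by (cases j) auto
    then show ?thesis
      using M[OF j'(2)] S'(2) dom[of _ j'] ij by (cases i) auto
  qed
  ultimately have "dominating_sets E S (Suc m + 2) ?M"
    by (simp add: dominating_sets_def)
  then show ?case
    by (rule exI[of _ ?M])
qed

section \<open>Translation to graphs\<close>

text \<open>Arcs with both ends in \<open>U\<close> survive in the induced subgraph, so walks
  staying in \<open>U\<close> do too.\<close>

lemma connected_induce_subgraph:
  assumes "connected_on (arcs_ends G) U"
  shows "Digraph_Component.connected (G \<restriction> U)"
proof -
  have "(x, y) \<in> rtrancl_on U ((arcs_ends (G \<restriction> U))\<^sup>s)"
    if "(x, y) \<in> rtrancl_on U (arcs_ends G)" for x y
    using that
  proof (induct rule: rtrancl_on_induct)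
    case (step y z)
    from \<open>y \<rightarrow>\<^bsub>G\<^esub> z\<close> obtain e where "e \<in> arcs G" "tail G e = y" "head G e = z"
      by (rule reachableE)
    with \<open>y \<in> U\<close> \<open>z \<in> U\<close> have "y \<rightarrow>\<^bsub>G \<restriction> U\<^esub> z"
      unfolding arcs_ends_conv by (intro image_eqI[of _ _ e]) simp_all
    then have "(y, z) \<in> (arcs_ends (G \<restriction> U))\<^sup>s"
      by (simp add: symcl_def)
    with step.hyps(5) show ?case
      using \<open>z \<in> U\<close> by (rule rtrancl_on_into_rtrancl_on)
  qed (rule rtrancl_on_refl)
  then show ?thesis
    using assms by (simp add: connected_on_def connected_conv)
qed

text \<open>Forgetting the order of a pair has fibres of size two: symmetry supplies the reversed
  pair, and the absence of loops makes it a different one.\<close>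

lemma (in digraph) card_arcs_ends:
  assumes "symmetric G"
  shows "card (arcs_ends G) = 2 * card (edges G)"
proof -
  let ?f = "\<lambda>(u, v). {u, v}"
  have fin: "finite (arcs_ends G)"
    by (simp add: arcs_ends_def)
  have edges: "edges G = ?f ` arcs_ends G"
    by (auto simp: edges_def)
  have fibre: "card {p \<in> arcs_ends G. ?f p = e} = 2" if "e \<in> edges G" for e
  proof -
    from that obtain u v where uv: "e = {u, v}" "u \<rightarrow>\<^bsub>G\<^esub> v"
      by (auto simp: edges_def)
    then have "{p \<in> arcs_ends G. ?f p = e} = {(u, v), (v, u)}"
      using assms by (auto simp: doubleton_eq_iff dest: arcs_ends_symmetric)
    moreover have "u \<noteq> v"
      using uv(2) adj_not_same by blast
    ultimately show ?thesis
      by simp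
  qed
  have "card (arcs_ends G) = (\<Sum>e\<in>edges G. card {p \<in> arcs_ends G. ?f p = e})"
    unfolding card_eq_sum edges by (rule sum.image_gen[OF fin])
  also have "\<dots> = (\<Sum>e\<in>edges G. 2)"
    by (rule sum.cong[OF refl fibre])
  finally show ?thesis
    by simp
qed

theorem theorem16:
  fixes G :: "('a, 'b) pre_digraph" and t :: nat
  assumes "t \<ge> 2"
    and "Digraph.graph G"
    and "verts G \<noteq> {}"
    and "average_degree G \<ge> 2 ^ (t - 2)"
  shows "\<exists>T. dominating_clique_model G t T"
proof -
  interpret graph G
    by (rule assms(2))
  let ?E = "arcs_ends G"
  have sym: "sym ?E"
    using sym_arcs by (simp add: symmetric_def)
  have irrefl: "irrefl ?E"
    unfolding irrefl_def using adj_not_same by blast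
  have "0 < real (card (verts G))"
    using assms(3) by (simp add: card_gt_0_iff)
  then have "2 ^ (t - 2) * real (card (verts G)) \<le> 2 * real (card (edges G))"
    using assms(4) by (simp only: average_degree_def pos_le_divide_eq)
  then have "real (2 ^ (t - 2) * card (verts G)) \<le> real (2 * card (edges G))"
    by (simp only: of_nat_mult of_nat_power of_nat_numeral)
  moreover have "?E \<inter> verts G \<times> verts G = ?E"
    by (auto intro: adj_in_verts)
  ultimately have "2 ^ (t - 2) * card (verts G) \<le> card (?E \<inter> verts G \<times> verts G)"
    using card_arcs_ends[OF sym_arcs] by (simp only: of_nat_le_iff)
  from dominating_sets_exist[OF sym irrefl finite_verts assms(3) this]
  obtain M where "dominating_sets ?E (verts G) t M"
    unfolding le_add_diff_inverse2[OF assms(1)] ..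
  then have M: "\<And>i. i < t \<Longrightarrow> M i \<subseteq> verts G \<and> connected_on ?E (M i)"
    and disj: "\<And>i j. i < t \<Longrightarrow> j < t \<Longrightarrow> i \<noteq> j \<Longrightarrow> M i \<inter> M j = {}"
    and dom: "\<And>i j. i < j \<Longrightarrow> j < t \<Longrightarrow> M j \<subseteq> ?E `` M i"
    by (simp_all add: dominating_sets_def)
  \<comment> \<open>The shift by one passes from indices below \<open>t\<close> to
    \<open>1, ..., t\<close>.\<close>
  let ?T = "\<lambda>i. G \<restriction> M (i - 1)"
  have M': "M (i - 1) \<subseteq> verts G \<and> connected_on ?E (M (i - 1))" if "i \<in> {1..t}" for i
    using that by (intro M) auto
  have ind: "induced_subgraph (?T i) G" if "i \<in> {1..t}" for i
    using M'[OF that] by (simp add: induced_induce)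
  have parts: "Digraph.graph (?T i) \<and> subgraph (?T i) G \<and> verts (?T i) \<noteq> {} \<and>
      Digraph_Component.connected (?T i)" if i: "i \<in> {1..t}" for i
  proof -
    have "Digraph.graph (?T i)"
      by (rule digraph.graphI[OF digraphI_induced[OF ind[OF i]]
            induced_graph_imp_symmetric[OF sym_arcs ind[OF i]]])
    moreover have "connected_on ?E (M (i - 1))"
      using M'[OF i] by simp
    moreover from this have "Digraph_Component.connected (?T i)"
      by (rule connected_induce_subgraph)
    ultimately show ?thesis
      using induced_imp_subgraph[OF ind[OF i]] by (simp add: connected_on_def)
  qed
  have disjoint: "verts (?T i) \<inter> verts (?T j) = {}"
    if "i \<in> {1..t}" "j \<in> {1..t}" "i \<noteq> j" for i j
    using that by (simp, intro disj) auto
  have dominating: "\<exists>u\<in>verts (?T i). v \<rightarrow>\<^bsub>G\<^esub> u"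
    if "1 \<le> i" "i < j" "j \<le> t" "v \<in> verts (?T j)" for i j v
  proof -
    have "M (j - 1) \<subseteq> ?E `` M (i - 1)"
      using that(1-3) by (intro dom) auto
    \<comment> \<open>The image yields an arc from \<open>M (i - 1)\<close> to \<open>v\<close>;
      symmetry reverses it.\<close>
    then show ?thesis
      using that(4) by simp (blast intro: symD[OF sym])
  qed
  have "dominating_clique_model G t ?T"
    unfolding dominating_clique_model_def
    by (rule conjI, rule ballI, erule parts, rule conjI, intro ballI impI, erule (2) disjoint,
        intro allI impI ballI, elim conjE, erule (3) dominating)
  then show ?thesis
    by (rule exI[of _ ?T])
qed

end
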